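(* Let $(X,d)$, $(Y,\rho)$ be semimetric spaces and let $f\colon X\to Y$ be a bijective $\eta$-quasisymmetric mapping. If $$\eta(k)\,\eta\left(\frac1k\right)=1$$ for all $k>0$, then $f$ is a weak similarity.
   Context: A semimetric on a nonempty set $X$ is a function $d\colon X\times X\to[0,\infty)$ with $d(x,y)=0\Leftrightarrow x=y$ and $d(x,y)=d(y,x)$; then $(X,d)$ is a semimetric space. Let $\eta\colon[0,\infty)\to[0,\infty)$ be a homeomorphism. A mapping $f\colon X\to Y$ between semimetric spaces $(X,d)$, $(Y,\rho)$ is $\eta$-quasisymmetric if $d(x,a)\leqslant t\,d(x,b)$ implies $\rho(f(x),f(a))\leqslant\eta(t)\rho(f(x),f(b))$ for all $a,b,x\in X$ and all $t>0$. The spectrum of $(X,d)$ is $\operatorname{Sp}(X)=\{d(x,y):x,y\in X\}$. A bijective mapping $f\colon X\to Y$ is a weak similarity if there is a strictly increasing bijection $\varphi\colon\operatorname{Sp}(X)\to\operatorname{Sp}(Y)$ such that $\varphi(d(x,y))=\rho(f(x),f(y))$ for all $x,y\in X$. *)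

theory Defs
  imports "HOL-Analysis.Analysis"
begin

text \<open>Spaces are given by a carrier set and a distance function; nothing is required of the
  distance outside the carrier.\<close>

definition semimetric_space :: "'a set \<Rightarrow> ('a \<Rightarrow> 'a \<Rightarrow> real) \<Rightarrow> bool" where
  "semimetric_space X d \<longleftrightarrow> X \<noteq> {} \<and>
     (\<forall>x\<in>X. \<forall>y\<in>X. 0 \<le> d x y \<and> (d x y = 0 \<longleftrightarrow> x = y) \<and> d x y = d y x)"

definition quasisymmetric ::
  "(real \<Rightarrow> real) \<Rightarrow> 'a set \<Rightarrow> ('a \<Rightarrow> 'a \<Rightarrow> real) \<Rightarrow> 'b set \<Rightarrow> ('b \<Rightarrow> 'b \<Rightarrow> real) \<Rightarrow> ('a \<Rightarrow> 'b) \<Rightarrow> bool" where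
  "quasisymmetric \<eta> X d Y \<rho> f \<longleftrightarrow> f \<in> X \<rightarrow> Y \<and>
     (\<forall>a\<in>X. \<forall>b\<in>X. \<forall>x\<in>X. \<forall>t>0. d x a \<le> t * d x b \<longrightarrow> \<rho> (f x) (f a) \<le> \<eta> t * \<rho> (f x) (f b))"

definition spectrum :: "'a set \<Rightarrow> ('a \<Rightarrow> 'a \<Rightarrow> real) \<Rightarrow> real set" where
  "spectrum X d = {d x y | x y. x \<in> X \<and> y \<in> X}"

definition weak_similarity ::
  "'a set \<Rightarrow> ('a \<Rightarrow> 'a \<Rightarrow> real) \<Rightarrow> 'b set \<Rightarrow> ('b \<Rightarrow> 'b \<Rightarrow> real) \<Rightarrow> ('a \<Rightarrow> 'b) \<Rightarrow> bool" where
  "weak_similarity X d Y \<rho> f \<longleftrightarrow> bij_betw f X Y \<and>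
     (\<exists>\<phi>. strict_mono_on (spectrum X d) \<phi> \<and> bij_betw \<phi> (spectrum X d) (spectrum Y \<rho>) \<and>
          (\<forall>x\<in>X. \<forall>y\<in>X. \<phi> (d x y) = \<rho> (f x) (f y)))"

end

theory Submission imports Defs
begin

text \<open>For \<open>b \<noteq> x\<close>, applying quasisymmetry with \<open>t = d x a / d x b\<close> and, after exchanging \<open>a\<close> and \<open>b\<close>,
  with \<open>1 / t\<close> gives, because \<open>\<eta> t * \<eta> (1 / t) = 1\<close>, the equality
  \<open>\<rho> (f x) (f a) = \<eta> (d x a / d x b) * \<rho> (f x) (f b)\<close>. Hence the distances from \<open>x\<close> and those from
  another point \<open>z\<close> are both measured by the one strictly increasing function
  \<open>s \<mapsto> \<eta> (s / d x z) * \<rho> (f x) (f z)\<close>, so \<open>d x y \<le> d z w\<close> iff \<open>\<rho> (f x) (f y) \<le> \<rho> (f z) (f w)\<close>.\<close>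

text \<open>A continuous injection on an interval is strictly monotone. The decreasing case is
  impossible: \<open>\<eta> 0\<close> would be the largest value, yet the image is unbounded
  above.\<close>

lemma homeomorphism_nonneg_strict_mono:
  fixes \<eta> g :: "real \<Rightarrow> real"
  assumes "homeomorphism {0..} {0..} \<eta> g"
  shows "strict_mono_on {0..} \<eta>"
proof -
  have cont: "continuous_on {0..} \<eta>" and img: "\<eta> ` {0..} = {0..}" and inj: "inj_on \<eta> {0..}"
    using assms by (auto simp: homeomorphism_def intro: inj_on_inverseI)
  have "strict_mono_on {0..} \<eta> \<or> strict_antimono_on {0..} \<eta>"
    using injective_eq_monotone_map[of "{0..}" \<eta>] cont inj by simp
  moreover have False if anti: "strict_antimono_on {0..} \<eta>"
  proof -
    have "0 \<le> \<eta> 0"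
      using img by auto
    then have "\<eta> 0 + 1 \<in> \<eta> ` {0..}"
      using img by simp
    then obtain u where u: "0 \<le> u" "\<eta> u = \<eta> 0 + 1"
      by auto
    then show False
      using monotone_onD[OF anti, of 0 u] by (cases "u = 0") auto
  qed
  ultimately show ?thesis
    by blast
qed

lemma homeomorphism_nonneg_zero:
  fixes \<eta> g :: "real \<Rightarrow> real"
  assumes "homeomorphism {0..} {0..} \<eta> g"
  shows "\<eta> 0 = 0"
proof -
  have img: "\<eta> ` {0..} = {0..}"
    using assms by (simp add: homeomorphism_def)
  then have "0 \<in> \<eta> ` {0..}"
    by simp
  then obtain u where u: "0 \<le> u" "\<eta> u = 0"
    by auto
  have "\<eta> 0 \<le> \<eta> u"
    using homeomorphism_nonneg_strict_mono[OF assms] u(1) by (simp add: strict_mono_on_leD)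
  moreover have "0 \<le> \<eta> 0"
    using img by auto
  ultimately show ?thesis
    using u(2) by simp
qed

lemma quasisymmetric_exact_ratio:
  assumes X: "semimetric_space X d" and Y: "semimetric_space Y \<rho>"
    and qs: "quasisymmetric \<eta> X d Y \<rho> f"
    and zero: "\<eta> 0 = 0" and pos: "\<And>t. t > 0 \<Longrightarrow> \<eta> t > 0"
    and recip: "\<forall>k>0. \<eta> k * \<eta> (1 / k) = 1"
    and mem: "x \<in> X" "a \<in> X" "b \<in> X" and "x \<noteq> b"
  shows "\<rho> (f x) (f a) = \<eta> (d x a / d x b) * \<rho> (f x) (f b)"
proof (cases "a = x")
  \<comment> \<open>Quasisymmetry only allows \<open>t > 0\<close>, so the ratio 0 is treated apart:
    both sides vanish because \<open>\<eta> 0 = 0\<close>.\<close>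
  case True
  have "f x \<in> Y"
    using qs mem(1) unfolding quasisymmetric_def by blast
  then have "\<rho> (f x) (f x) = 0"
    using Y unfolding semimetric_space_def by blast
  moreover have "d x x = 0"
    using X mem(1) unfolding semimetric_space_def by blast
  ultimately show ?thesis
    using True zero by simp
next
  case False
  define t where "t = d x a / d x b"
  have d: "d x a > 0" "d x b > 0"
    using X mem \<open>x \<noteq> b\<close> False unfolding semimetric_space_def less_le by metis+
  then have t: "t > 0" "d x a = t * d x b" "d x b = 1 / t * d x a"
    by (simp_all add: t_def)
  have qsD: "\<rho> (f x) (f a') \<le> \<eta> s * \<rho> (f x) (f b')"
    if "a' \<in> X" "b' \<in> X" "s > 0" "d x a' = s * d x b'" for a' b' s
    using qs mem(1) that unfolding quasisymmetric_def by simp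
  have le: "\<rho> (f x) (f a) \<le> \<eta> t * \<rho> (f x) (f b)"
    using qsD mem(2,3) t(1,2) by blast
  have "1 / t > 0"
    using t(1) by simp
  then have "\<rho> (f x) (f b) \<le> \<eta> (1 / t) * \<rho> (f x) (f a)"
    using qsD mem(2,3) t(3) by blast
  \<comment> \<open>Multiplying by \<open>\<eta> t\<close> cancels \<open>\<eta> (1 / t)\<close> and
    turns the bound with \<open>a\<close> and \<open>b\<close> exchanged into the reverse of
    \<open>le\<close>.\<close>
  then have "\<eta> t * \<rho> (f x) (f b) \<le> \<eta> t * (\<eta> (1 / t) * \<rho> (f x) (f a))"
    using pos[OF t(1)] by simp
  also have "\<dots> = \<rho> (f x) (f a)"
    using recip t(1) by (metis mult.assoc mult_1)
  finally show ?thesis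
    using le by (simp add: t_def)
qed

lemma weak_similarityI:
  assumes bij: "bij_betw f X Y"
    and iff: "\<And>x y z w. \<lbrakk>x \<in> X; y \<in> X; z \<in> X; w \<in> X\<rbrakk> \<Longrightarrow>
      d x y \<le> d z w \<longleftrightarrow> \<rho> (f x) (f y) \<le> \<rho> (f z) (f w)"
  shows "weak_similarity X d Y \<rho> f"
proof -
  \<comment> \<open>The choice is harmless on the spectrum, where only one \<open>r\<close>
    qualifies; elsewhere the value is arbitrary.\<close>
  define \<phi> where "\<phi> s = (SOME r. \<exists>x\<in>X. \<exists>y\<in>X. d x y = s \<and> r = \<rho> (f x) (f y))" for s
  have \<phi>: "\<phi> (d x y) = \<rho> (f x) (f y)" if xy: "x \<in> X" "y \<in> X" for x y
    unfolding \<phi>_def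
  proof (rule some_equality)
    fix r assume "\<exists>x'\<in>X. \<exists>y'\<in>X. d x' y' = d x y \<and> r = \<rho> (f x') (f y')"
    then obtain x' y' where "x' \<in> X" "y' \<in> X" "d x' y' = d x y" "r = \<rho> (f x') (f y')"
      by blast
    then show "r = \<rho> (f x) (f y)"
      using iff[of x y x' y'] iff[of x' y' x y] xy by simp
  qed (use xy in blast)
  have mono: "strict_mono_on (spectrum X d) \<phi>"
  proof (rule strict_mono_onI)
    fix r s assume "r \<in> spectrum X d" "s \<in> spectrum X d" "r < s"
    then obtain x y z w where mem: "x \<in> X" "y \<in> X" "z \<in> X" "w \<in> X"
      and rs: "r = d x y" "s = d z w"
      unfolding spectrum_def by blast
    then show "\<phi> r < \<phi> s"
      using iff[of z w x y] \<open>r < s\<close> by (simp add: \<phi>)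
  qed
  have "spectrum Y \<rho> = {\<rho> (f x) (f y) |x y. x \<in> X \<and> y \<in> X}"
  proof -
    have "Y = f ` X"
      using bij by (simp add: bij_betw_def)
    then show ?thesis
      unfolding spectrum_def by blast
  qed
  also have "\<dots> = \<phi> ` spectrum X d"
  proof (intro equalityI subsetI)
    fix r assume "r \<in> {\<rho> (f x) (f y) |x y. x \<in> X \<and> y \<in> X}"
    then obtain x y where "x \<in> X" "y \<in> X" "r = \<phi> (d x y)"
      using \<phi> by force
    then show "r \<in> \<phi> ` spectrum X d"
      unfolding spectrum_def by blast
  next
    fix r assume "r \<in> \<phi> ` spectrum X d"
    then obtain x y where "x \<in> X" "y \<in> X" "r = \<phi> (d x y)"
      unfolding spectrum_def by blast
    then show "r \<in> {\<rho> (f x) (f y) |x y. x \<in> X \<and> y \<in> X}"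
      using \<phi> by blast
  qed
  finally have "bij_betw \<phi> (spectrum X d) (spectrum Y \<rho>)"
    using strict_mono_on_imp_inj_on[OF mono] by (simp add: bij_betw_def)
  then show ?thesis
    using bij mono \<phi> unfolding weak_similarity_def by blast
qed

theorem theorem5p7:
  fixes X :: "'a set" and d :: "'a \<Rightarrow> 'a \<Rightarrow> real"
    and Y :: "'b set" and \<rho> :: "'b \<Rightarrow> 'b \<Rightarrow> real"
    and \<eta> :: "real \<Rightarrow> real" and f :: "'a \<Rightarrow> 'b"
  assumes "semimetric_space X d"
    and "semimetric_space Y \<rho>"
    and "\<exists>g. homeomorphism {0..} {0..} \<eta> g"
    and "bij_betw f X Y"
    and "quasisymmetric \<eta> X d Y \<rho> f"
    and "\<forall>k>0. \<eta> k * \<eta> (1 / k) = 1"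
  shows "weak_similarity X d Y \<rho> f"
proof (rule weak_similarityI[OF assms(4)])
  obtain g where g: "homeomorphism {0..} {0..} \<eta> g"
    using assms(3) by blast
  note mono = homeomorphism_nonneg_strict_mono[OF g]
  note zero = homeomorphism_nonneg_zero[OF g]
  have pos: "\<eta> t > 0" if "t > 0" for t
    using strict_mono_onD[OF mono, of 0 t] that zero by simp
  note ratio = quasisymmetric_exact_ratio[OF assms(1,2,5) zero pos assms(6)]
  fix x y z w assume mem: "x \<in> X" "y \<in> X" "z \<in> X" "w \<in> X"
  have fmem: "f x \<in> Y" "f y \<in> Y" "f z \<in> Y" "f w \<in> Y"
    using mem assms(4) by (auto simp: bij_betw_def)
  show "d x y \<le> d z w \<longleftrightarrow> \<rho> (f x) (f y) \<le> \<rho> (f z) (f w)"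
  proof (cases "\<exists>b\<in>X. b \<noteq> x")
    \<comment> \<open>With a single point there is no nonzero distance to serve as a unit.\<close>
    case False
    then have "y = x" "z = x" "w = x"
      using mem by blast+
    then show ?thesis
      by simp
  next
    case True
    obtain r c where rc: "r > 0" "c > 0"
      and xy: "\<rho> (f x) (f y) = \<eta> (d x y / r) * c" and zw: "\<rho> (f z) (f w) = \<eta> (d z w / r) * c"
    proof -
      \<comment> \<open>If \<open>z \<noteq> x\<close>, the segment from \<open>x\<close> to
        \<open>z\<close> is the common unit: symmetry of \<open>d\<close> and \<open>\<rho>\<close>
        lets it be read from either base point. If \<open>z = x\<close>, there is one base point and
        any other \<open>b\<close> will do.\<close>
      obtain b where b: "b \<in> X" "b \<noteq> x" "z \<noteq> x \<Longrightarrow> b = z"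
        using True mem(3) by metis
      have "f b \<in> Y" "f x \<noteq> f b"
        using b mem(1) assms(4) by (auto simp: bij_betw_def inj_on_def)
      then have *: "d x b > 0" "\<rho> (f x) (f b) > 0"
        using assms(1,2) b(1,2) mem(1) fmem(1) unfolding semimetric_space_def less_le by metis+
      have "\<rho> (f z) (f w) = \<eta> (d z w / d x b) * \<rho> (f x) (f b)"
      proof (cases "z = x")
        case True
        then show ?thesis
          using ratio[of x w b] b mem by simp
      next
        case False
        moreover have "d z x = d x z"
          using assms(1) mem(1,3) unfolding semimetric_space_def by metis
        moreover have "\<rho> (f z) (f x) = \<rho> (f x) (f z)"
          using assms(2) fmem(1,3) unfolding semimetric_space_def by metis
        ultimately show ?thesis
          using ratio[of z w x] b(3) mem by simp
      qed
      then show thesis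
        using that[OF *] ratio[of x y b] b mem by simp
    qed
    have "0 \<le> d x y" "0 \<le> d z w"
      using assms(1) mem unfolding semimetric_space_def by blast+
    then have "d x y / r \<in> {0..}" "d z w / r \<in> {0..}"
      using rc(1) by simp_all
    \<comment> \<open>As \<open>r\<close> and \<open>c\<close> are positive and shared by both
      pairs, comparing the distances reduces to monotonicity of \<open>\<eta>\<close>.\<close>
    then have "\<eta> (d x y / r) \<le> \<eta> (d z w / r) \<longleftrightarrow> d x y / r \<le> d z w / r"
      by (rule strict_mono_on_less_eq[OF mono])
    then show ?thesis
      using rc by (simp add: xy zw divide_le_cancel)
  qed
qed

end
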